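(* Let $0\le\alpha\le 1$ and $\beta=1-\alpha$. Let $G_1$ be a simple connected graph on $n_1$ vertices with $\alpha$-eigenvalues $\nu_1,\dots,\nu_{n_1}$, and let $G_2$ be a simple connected $k$-regular graph on $n_2$ vertices with $\alpha$-eigenvalues $k=\eta_1\ge\eta_2\ge\dots\ge\eta_{n_2}$. Then the $\alpha$-eigenvalues of the corona $G=G_1\circ G_2$ (counted with multiplicity) are: (i) for each $i=1,\dots,n_1$, the two values $$\frac{\nu_i+k+\alpha(n_2+1)\pm\sqrt{\alpha^2n_2^2+(k+\alpha-\nu_i)^2+2n_2\bigl(2+\alpha(\nu_i+\alpha-k-4)\bigr)}}{2};$$ (ii) for each $j=2,\dots,n_2$, the value $\eta_j+\alpha$, with multiplicity $n_1$.
   Context: All graphs are simple, undirected and connected. For a graph $G$ with adjacency matrix $A(G)$ and diagonal degree matrix $D(G)$, and $0\le\alpha\le1$, $A_\alpha(G)=\alpha D(G)+(1-\alpha)A(G)$; its eigenvalues are the $\alpha$-eigenvalues of $G$. The corona $G_1\circ G_2$ of $G_1$ (on $n_1$ vertices) and $G_2$ is obtained by taking one copy of $G_1$ and $n_1$ copies of $G_2$, and joining the $i$-th vertex of $G_1$ to every vertex of the $i$-th copy of $G_2$. *)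

theory Defs
  imports
    "Graph_Theory.Graph_Theory"
    "Jordan_Normal_Form.Char_Poly"
begin

text \<open>
  Finite simple undirected graphs are the symmetric loop-free digraphs of \<^locale>\<open>pair_graph\<close>:
  an edge \<open>uv\<close> is the pair of arcs \<open>(u,v)\<close>, \<open>(v,u)\<close>, so the degree of a vertex is its
  \<^const>\<open>out_degree\<close>. Graph matrices are taken with respect to a listing \<open>vs\<close> of the vertices.
\<close>

definition adjacency_matrix :: "'a list \<Rightarrow> 'a pair_pre_digraph \<Rightarrow> real mat" where
  "adjacency_matrix vs G =
     mat (length vs) (length vs) (\<lambda>(i, j). if (vs ! i, vs ! j) \<in> parcs G then 1 else 0)"

definition degree_matrix :: "'a list \<Rightarrow> 'a pair_pre_digraph \<Rightarrow> real mat" where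
  "degree_matrix vs G =
     mat (length vs) (length vs)
       (\<lambda>(i, j). if i = j then real (out_degree (with_proj G) (vs ! i)) else 0)"

definition A_alpha :: "real \<Rightarrow> 'a list \<Rightarrow> 'a pair_pre_digraph \<Rightarrow> real mat" where
  "A_alpha \<alpha> vs G = \<alpha> \<cdot>\<^sub>m degree_matrix vs G + (1 - \<alpha>) \<cdot>\<^sub>m adjacency_matrix vs G"

definition vertex_list :: "'a pair_pre_digraph \<Rightarrow> 'a list" where
  "vertex_list G = (SOME vs. distinct vs \<and> set vs = pverts G)"

text \<open>
  Eigenvalues with multiplicity. The matrix is real symmetric, so its characteristic polynomial
  splits over the reals and algebraic and geometric multiplicities agree. The chosen listing of
  the vertices does not matter, see \<open>alpha_eigenvalues_eq\<close> below.
\<close>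

definition alpha_eigenvalues :: "real \<Rightarrow> 'a pair_pre_digraph \<Rightarrow> real multiset" where
  "alpha_eigenvalues \<alpha> G = proots (char_poly (A_alpha \<alpha> (vertex_list G) G))"

definition regular_graph :: "nat \<Rightarrow> 'a pair_pre_digraph \<Rightarrow> bool" where
  "regular_graph k G \<longleftrightarrow> (\<forall>v \<in> pverts G. out_degree (with_proj G) v = k)"

text \<open>\<open>Inr (u, x)\<close> is the vertex \<open>x\<close> in the copy of \<open>H\<close> that belongs to the vertex \<open>u\<close> of \<open>G\<close>.\<close>

definition corona ::
    "'a pair_pre_digraph \<Rightarrow> 'b pair_pre_digraph \<Rightarrow> ('a + 'a \<times> 'b) pair_pre_digraph" where
  "corona G H =
     \<lparr> pverts = Inl ` pverts G \<union> Inr ` (pverts G \<times> pverts H),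
       parcs = {(Inl u, Inl v) | u v. (u, v) \<in> parcs G}
             \<union> {(Inr (u, x), Inr (u, y)) | u x y. u \<in> pverts G \<and> (x, y) \<in> parcs H}
             \<union> {(Inl u, Inr (u, x)) | u x. u \<in> pverts G \<and> x \<in> pverts H}
             \<union> {(Inr (u, x), Inl u) | u x. u \<in> pverts G \<and> x \<in> pverts H} \<rparr>"

lemma A_alpha_carrier [simp]: "A_alpha \<alpha> vs G \<in> carrier_mat (length vs) (length vs)"
  by (simp add: A_alpha_def degree_matrix_def adjacency_matrix_def)

lemma A_alpha_index:
  assumes "i < length vs" "j < length vs" "distinct vs"
  shows "A_alpha \<alpha> vs G $$ (i, j) =
    \<alpha> * (if vs ! i = vs ! j then real (out_degree (with_proj G) (vs ! i)) else 0)
    + (1 - \<alpha>) * (if (vs ! i, vs ! j) \<in> parcs G then 1 else 0)"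
  using assms
  by (simp add: A_alpha_def degree_matrix_def adjacency_matrix_def nth_eq_iff_index_eq)

lemma char_poly_A_alpha_listing:
  assumes vs: "distinct vs" and ws: "distinct ws" and eq: "set ws = set vs"
  shows "char_poly (A_alpha \<alpha> ws G) = char_poly (A_alpha \<alpha> vs G)"
proof -
  define n where "n = length vs"
  have len: "length ws = n"
    using assms by (metis distinct_card n_def)
  have "\<exists>j<n. vs ! j = ws ! i" if "i < n" for i
    using that len eq n_def by (metis in_set_conv_nth)
  then obtain f where f: "\<And>i. i < n \<Longrightarrow> f i < n \<and> vs ! f i = ws ! i"
    by metis
  have inj: "i = j" if "i < n" "j < n" "f i = f j" for i j
    using f[OF that(1)] f[OF that(2)] that ws len by (metis nth_eq_iff_index_eq)
  define P :: "real mat" where "P = mat n n (\<lambda>(i, j). if j = f i then 1 else 0)"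
  define Q :: "real mat" where "Q = mat n n (\<lambda>(i, j). if i = f j then 1 else 0)"
  let ?A = "A_alpha \<alpha> vs G" and ?B = "A_alpha \<alpha> ws G"
  have A: "?A \<in> carrier_mat n n" and B: "?B \<in> carrier_mat n n"
    using A_alpha_carrier[of \<alpha> vs G] A_alpha_carrier[of \<alpha> ws G] by (simp_all add: n_def len)
  have P: "P \<in> carrier_mat n n" and Q: "Q \<in> carrier_mat n n"
    by (simp_all add: P_def Q_def)
  have mult: "(X * Y) $$ (i, j) = (\<Sum>l = 0..<n. X $$ (i, l) * Y $$ (l, j))"
    if "X \<in> carrier_mat n n" "Y \<in> carrier_mat n n" "i < n" "j < n" for X Y :: "real mat" and i j
    using that by (simp add: scalar_prod_def)
  have "(P * Q) $$ (i, j) = (1\<^sub>m n :: real mat) $$ (i, j)" if "i < n" "j < n" for i j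
  proof -
    have "(P * Q) $$ (i, j) = (\<Sum>l = 0..<n. P $$ (i, l) * Q $$ (l, j))"
      using mult[OF P Q that] .
    also have "\<dots> = (\<Sum>l = 0..<n. if l = f i then (if f i = f j then 1 else 0) else 0)"
      by (rule sum.cong) (use that in \<open>simp_all add: P_def Q_def\<close>)
    also have "\<dots> = (if f i = f j then 1 else 0)"
      using f[OF that(1)] by simp
    also have "\<dots> = (1\<^sub>m n :: real mat) $$ (i, j)"
      using that inj[OF that] by auto
    finally show ?thesis .
  qed
  then have PQ: "P * Q = 1\<^sub>m n"
    using P Q by (intro eq_matI) auto
  have QP: "Q * P = 1\<^sub>m n"
    using mat_mult_left_right_inverse[OF P Q PQ] .
  have PA: "(P * ?A) $$ (i, j) = ?A $$ (f i, j)" if "i < n" "j < n" for i j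
  proof -
    have "(P * ?A) $$ (i, j) = (\<Sum>l = 0..<n. P $$ (i, l) * ?A $$ (l, j))"
      using mult[OF P A that] .
    also have "\<dots> = (\<Sum>l = 0..<n. if l = f i then ?A $$ (l, j) else 0)"
      by (rule sum.cong) (use that in \<open>simp_all add: P_def\<close>)
    also have "\<dots> = ?A $$ (f i, j)"
      using f[OF that(1)] by simp
    finally show ?thesis .
  qed
  have "(P * ?A * Q) $$ (i, j) = ?A $$ (f i, f j)" if "i < n" "j < n" for i j
  proof -
    have "(P * ?A * Q) $$ (i, j) = (\<Sum>l = 0..<n. (P * ?A) $$ (i, l) * Q $$ (l, j))"
      using mult[OF mult_carrier_mat[OF P A] Q that] .
    also have "\<dots> = (\<Sum>l = 0..<n. if l = f j then ?A $$ (f i, l) else 0)"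
      by (rule sum.cong) (use that in \<open>simp_all add: PA Q_def del: index_mult_mat\<close>)
    also have "\<dots> = ?A $$ (f i, f j)"
      using f[OF that(2)] by simp
    finally show ?thesis .
  qed
  moreover have "?A $$ (f i, f j) = ?B $$ (i, j)" if "i < n" "j < n" for i j
    using f[OF that(1)] f[OF that(2)] that vs ws len
    by (subst (1 2) A_alpha_index) (simp_all add: n_def)
  ultimately have "?B = P * ?A * Q"
    using A B P Q by (intro eq_matI) auto
  then have "similar_mat ?B ?A"
    unfolding similar_mat_def similar_mat_wit_def Let_def
    using A B P Q PQ QP by (intro exI[of _ P] exI[of _ Q]) auto
  then show ?thesis
    by (rule char_poly_similar)
qed

lemma alpha_eigenvalues_eq:
  assumes "distinct vs" "set vs = pverts G"
  shows "alpha_eigenvalues \<alpha> G = proots (char_poly (A_alpha \<alpha> vs G))"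
proof -
  have "distinct (vertex_list G) \<and> set (vertex_list G) = pverts G"
    unfolding vertex_list_def by (rule someI[of _ vs]) (use assms in simp)
  then show ?thesis
    unfolding alpha_eigenvalues_def using assms char_poly_A_alpha_listing by metis
qed

end

theory Submission
  imports Defs
begin

text \<open>
  List the vertices of the corona as those of \<open>G1\<close> followed by the copies of \<open>G2\<close>. Then
  \<open>x I - A\<^sub>\<alpha>\<close> is a block matrix with lower right block \<open>I \<otimes> D\<close>, where
  \<open>D = (x - \<alpha>) I - A\<^sub>\<alpha>(G2)\<close>, and off-diagonal blocks built from the all-ones vector. By
  regularity the all-ones vector is an eigenvector of \<open>D\<close> for \<open>x - \<alpha> - k\<close>, so for
  \<open>x \<noteq> \<alpha> + k\<close> an explicit column operation clears the lower left block, and the determinant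
  becomes \<open>\<chi>\<^sub>1(x - \<alpha> n\<^sub>2 - (1 - \<alpha>)\<^sup>2 n\<^sub>2 / (x - \<alpha> - k)) \<chi>\<^sub>2(x - \<alpha>)\<close> with the second factor
  raised to the power \<open>n\<^sub>1\<close>. The factors \<open>x - \<alpha> - k\<close> of the second part cancel the denominators
  of the first, leaving a quadratic in \<open>x\<close> for every \<open>\<nu>\<^sub>i\<close>. Agreement at all but one point gives
  equality of polynomials.
\<close>

section \<open>Polynomials that split, and characteristic polynomials with known roots\<close>

lemma proots_split:
  fixes p :: "'a :: idom poly"
  assumes "p \<noteq> 0"
  obtains r where "p = (\<Prod>x\<in>#proots p. [:-x, 1:]) * r" and "r \<noteq> 0"
proof -
  \<comment> \<open>The induction splits off the full power of one linear factor at a time. It also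
    passes through the zero polynomial, where r = 0 serves, so r \<noteq> 0 is only derived
    afterwards.\<close>
  have "\<exists>r. p = (\<Prod>x\<in>#proots p. [:-x, 1:]) * r"
  proof (induction p rule: poly_root_order_induct)
    case (root p x n)
    then obtain r where r: "p = (\<Prod>x\<in>#proots p. [:-x, 1:]) * r"
      by blast
    have "p \<noteq> 0"
      using root by auto
    then have "proots ([:-x, 1:] ^ n * p) = replicate_mset n x + proots p"
      by (subst proots_mult) (auto simp: proots_power)
    then have "[:-x, 1:] ^ n * p = (\<Prod>y\<in>#proots ([:-x, 1:] ^ n * p). [:-y, 1:]) * r"
      by (subst r) (simp add: mult.assoc)
    then show ?case ..
  next
    case (no_roots p)
    then have "proots p = {#}"
      by (intro multiset_eqI) (auto simp: order_root)
    then show ?case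
      by simp
  qed simp
  then show thesis
    using that assms by (metis mult_zero_right)
qed

text \<open>As many roots as the degree leave only a constant cofactor in
  \<open>proots_split\<close>, and comparing leading coefficients makes it 1.\<close>

lemma monic_eq_prod_proots:
  fixes p :: "'a :: idom poly"
  assumes "monic p" and "size (proots p) = degree p"
  shows "p = (\<Prod>x\<in>#proots p. [:-x, 1:])"
proof -
  let ?q = "\<Prod>x\<in>#proots p. [:-x, 1:]"
  have "p \<noteq> 0"
    using assms(1) by auto
  then obtain r where r: "p = ?q * r" and "r \<noteq> 0"
    by (rule proots_split)
  have q: "degree (\<Prod>x\<in>#M. [:-x, 1:]) = size M \<and> monic (\<Prod>x\<in>#M. [:-x, 1:])"
    for M :: "'a multiset"
  proof (induction M)
    case (add x M)
    then have "(\<Prod>x\<in>#M. [:-x, 1:]) \<noteq> 0"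
      by auto
    then have "degree ([:-x, 1:] * (\<Prod>x\<in>#M. [:-x, 1:])) = Suc (size M)"
      using add by (subst degree_mult_eq) auto
    moreover have "monic ([:-x, 1:] * (\<Prod>x\<in>#M. [:-x, 1:]))"
      using add by (subst lead_coeff_mult) auto
    ultimately show ?case
      by simp
  qed simp
  then have "?q \<noteq> 0"
    by (metis leading_coeff_0_iff zero_neq_one)
  then have "degree p = degree ?q + degree r"
    using \<open>r \<noteq> 0\<close> degree_mult_eq[of ?q r] r by simp
  then have "degree r = 0"
    using q assms(2) by simp
  moreover have "lead_coeff p = lead_coeff ?q * lead_coeff r"
    using lead_coeff_mult[of ?q r] r by simp
  then have "lead_coeff r = 1"
    using q[of "proots p"] assms(1) by (metis mult_1)
  ultimately have "r = 1"
    by (metis degree_eq_zeroE lead_coeff_pCons(2) one_pCons)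
  with r show ?thesis
    by simp
qed

text \<open>An assumed list of n eigenvalues of an n by n matrix already forces the characteristic
  polynomial to split, by counting; the spectral theorem is not invoked.\<close>

lemma poly_char_poly_eq_prod:
  fixes A :: "'a :: field mat"
  assumes "A \<in> carrier_mat n n" and "proots (char_poly A) = image_mset f (mset_set I)"
    and "card I = n" and "finite I"
  shows "poly (char_poly A) x = (\<Prod>i\<in>I. x - f i)"
proof -
  have "char_poly A = (\<Prod>x\<in>#proots (char_poly A). [:-x, 1:])"
    using degree_monic_char_poly[OF assms(1)] assms(2-4) by (intro monic_eq_prod_proots) auto
  also have "\<dots> = (\<Prod>i\<in>I. [:- f i, 1:])"
    by (simp add: assms(2) image_mset.compositionality comp_def prod_unfold_prod_mset)
  finally show ?thesis
    by (simp add: poly_prod)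
qed

section \<open>Characteristic polynomials as determinants, and determinants of block
  matrices\<close>

lemma poly_char_poly_eq_det:
  fixes A :: "'a :: field mat"
  assumes A: "A \<in> carrier_mat n n"
  shows "poly (char_poly A) x = det (mat n n (\<lambda>(i, j). (if i = j then x else 0) - A $$ (i, j)))"
proof -
  have "- char_matrix A x = mat n n (\<lambda>(i, j). (if i = j then x else 0) - A $$ (i, j))"
    using A by (intro eq_matI) (auto simp: char_matrix_def)
  with char_poly_matrix[OF A] show ?thesis
    by simp
qed

text \<open>Multiplying on the right by a unit lower triangular block matrix adds combinations of
  the last m columns to the first n and clears \<open>C\<close>. For invertible \<open>D\<close> the
  matrix \<open>X\<close> is -D^(-1) C and \<open>A + B * X\<close> is the Schur complement; the
  form with \<open>X\<close> avoids inverses.\<close>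

lemma det_four_block_mat_eliminate:
  fixes A :: "'a :: idom mat"
  assumes A: "A \<in> carrier_mat n n" and B: "B \<in> carrier_mat n m" and C: "C \<in> carrier_mat m n"
    and D: "D \<in> carrier_mat m m" and X: "X \<in> carrier_mat m n" and 0: "C + D * X = 0\<^sub>m m n"
  shows "det (four_block_mat A B C D) = det (A + B * X) * det D"
proof -
  let ?M = "four_block_mat A B C D" and ?E = "four_block_mat (1\<^sub>m n) (0\<^sub>m n m) X (1\<^sub>m m)"
  have "?M * ?E = four_block_mat (A + B * X) B (0\<^sub>m m n) D"
    using assms by (subst mult_four_block_mat[where ?n2.0 = m]) auto
  then have "det (?M * ?E) = det (A + B * X) * det D"
    using assms by (simp add: det_four_block_mat_lower_left_zero[of _ n _ m])
  moreover have "det ?E = 1"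
    using X by (subst det_four_block_mat_upper_right_zero[of _ n _ m]) auto
  moreover have "det (?M * ?E) = det ?M * det ?E"
    using assms by (intro det_mult[of _ "n + m"]) auto
  ultimately show ?thesis
    by simp
qed

text \<open>The matrix is the Kronecker product of the identity of size m with \<open>D\<close>,
  indexed by quotient and remainder; the induction splits off its first block.\<close>

lemma det_block_diagonal:
  fixes D :: "'a :: idom mat"
  assumes D: "D \<in> carrier_mat n n"
  shows "det (mat (m * n) (m * n)
    (\<lambda>(i, j). if i div n = j div n then D $$ (i mod n, j mod n) else 0)) = det D ^ m"
proof (induction m)
  case (Suc m)
  let ?M = "\<lambda>m. mat (m * n) (m * n)
    (\<lambda>(i, j). if i div n = j div n then D $$ (i mod n, j mod n) else 0)"
  have "?M (Suc m) = four_block_mat D (0\<^sub>m n (m * n)) (0\<^sub>m (m * n) n) (?M m)"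
  proof (rule eq_matI)
    fix i j
    assume "i < dim_row (four_block_mat D (0\<^sub>m n (m * n)) (0\<^sub>m (m * n) n) (?M m))"
      and "j < dim_col (four_block_mat D (0\<^sub>m n (m * n)) (0\<^sub>m (m * n) n) (?M m))"
    then have "i < n + m * n" "j < n + m * n"
      using D by auto
    moreover have "n > 0"
      using calculation by (cases n) auto
    ultimately show "?M (Suc m) $$ (i, j) =
        four_block_mat D (0\<^sub>m n (m * n)) (0\<^sub>m (m * n) n) (?M m) $$ (i, j)"
      using D by (auto simp: not_less le_div_geq le_mod_geq)
  qed (use D in auto)
  then have "det (?M (Suc m)) = det D * det (?M m)"
    using D by (simp add: det_four_block_mat_lower_left_zero[of _ n _ "m * n"])
  with Suc show ?case
    by simp
qed simp

lemma sum_div_mod: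
  fixes f :: "nat \<Rightarrow> nat \<Rightarrow> 'a :: comm_monoid_add"
  shows "(\<Sum>l = 0..<m * n. f (l div n) (l mod n)) = (\<Sum>a<m. \<Sum>b<n. f a b)"
proof (cases "n = 0")
  case False
  have "(\<Sum>l = 0..<m * n. f (l div n) (l mod n)) =
      (\<Sum>a<m. \<Sum>l = a * n..<a * n + n. f (l div n) (l mod n))"
    by (simp add: sum.nat_group atLeast0LessThan)
  also have "\<dots> = (\<Sum>a<m. \<Sum>b<n. f a b)"
  proof (rule sum.cong)
    fix a
    have "(\<Sum>l = a * n..<a * n + n. f (l div n) (l mod n)) =
        (\<Sum>b = 0..<n. f ((b + a * n) div n) ((b + a * n) mod n))"
      using sum.shift_bounds_nat_ivl[of "\<lambda>l. f (l div n) (l mod n)" 0 "a * n" n]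
      by (simp add: add.commute)
    also have "\<dots> = (\<Sum>b<n. f a b)"
      using False by (auto simp: atLeast0LessThan intro!: sum.cong)
    finally show "(\<Sum>l = a * n..<a * n + n. f (l div n) (l mod n)) = (\<Sum>b<n. f a b)" .
  qed simp
  finally show ?thesis .
qed simp

text \<open>The all-ones vector is an eigenvector of \<open>D\<close> for s, so the Schur complement
  changes \<open>A\<close> only by a scalar matrix.\<close>

lemma det_corona_block:
  fixes A D :: "'a :: field mat"
  assumes A: "A \<in> carrier_mat m m" and D: "D \<in> carrier_mat n n"
    and row_sum: "\<And>i. i < n \<Longrightarrow> (\<Sum>j<n. D $$ (i, j)) = s" and s: "s \<noteq> 0"
  shows "det (four_block_mat A
      (mat m (m * n) (\<lambda>(i, j). if i = j div n then - b else 0))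
      (mat (m * n) m (\<lambda>(i, j). if i div n = j then - b else 0))
      (mat (m * n) (m * n) (\<lambda>(i, j). if i div n = j div n then D $$ (i mod n, j mod n) else 0)))
    = det (mat m m (\<lambda>(i, j). A $$ (i, j) - (if i = j then b\<^sup>2 * of_nat n / s else 0))) * det D ^ m"
proof -
  let ?B = "mat m (m * n) (\<lambda>(i, j). if i = j div n then - b else 0)"
  let ?C = "mat (m * n) m (\<lambda>(i, j). if i div n = j then - b else 0)"
  let ?D = "mat (m * n) (m * n)
    (\<lambda>(i, j). if i div n = j div n then D $$ (i mod n, j mod n) else 0)"
  \<comment> \<open>Column j of \<open>?C\<close> is -b times the indicator of block j, and
    \<open>?D\<close> multiplies this indicator by s, so b / s is the coefficient that cancels
    it.\<close>
  let ?X = "mat (m * n) m (\<lambda>(i, j). if i div n = j then b / s else 0)"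
  have "(?D * ?X) $$ (i, j) = (if i div n = j then b else 0)" if ij: "i < m * n" "j < m" for i j
  proof -
    have "n > 0"
      using ij by (cases n) auto
    have "(?D * ?X) $$ (i, j) = (\<Sum>l = 0..<m * n.
        (if i div n = l div n then D $$ (i mod n, l mod n) else 0) *
        (if l div n = j then b / s else 0))"
      using ij by (simp add: scalar_prod_def)
    also have "\<dots> = (\<Sum>a<m. \<Sum>c<n. (if i div n = a then D $$ (i mod n, c) else 0) *
        (if a = j then b / s else 0))"
      by (rule sum_div_mod[of "\<lambda>a c. (if i div n = a then D $$ (i mod n, c) else 0) *
        (if a = j then b / s else 0)"])
    also have "\<dots> = (\<Sum>a<m. if a = j then
        (if i div n = j then (\<Sum>c<n. D $$ (i mod n, c)) * (b / s) else 0) else 0)"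
      by (intro sum.cong) (auto simp: sum_distrib_right sum_divide_distrib)
    also have "\<dots> = (if i div n = j then b else 0)"
      using ij s \<open>n > 0\<close> by (simp add: row_sum)
    finally show ?thesis .
  qed
  then have "?C + ?D * ?X = 0\<^sub>m (m * n) m"
    by (intro eq_matI) (auto simp del: index_mult_mat(1))
  then have "det (four_block_mat A ?B ?C ?D) = det (A + ?B * ?X) * det ?D"
    using A by (intro det_four_block_mat_eliminate[of _ m _ "m * n"]) auto
  \<comment> \<open>Distinct blocks do not overlap, and the n positions of a common block contribute
    -b * (b / s) each.\<close>
  moreover have "(?B * ?X) $$ (i, j) = - (if i = j then b\<^sup>2 * of_nat n / s else 0)"
    if ij: "i < m" "j < m" for i j
  proof -
    have "(?B * ?X) $$ (i, j) = (\<Sum>l = 0..<m * n.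
        (if i = l div n then - b else 0) * (if l div n = j then b / s else 0))"
      using ij by (simp add: scalar_prod_def)
    also have "\<dots> = (\<Sum>a<m. \<Sum>c<n. (if i = a then - b else 0) * (if a = j then b / s else 0))"
      by (rule sum_div_mod[of "\<lambda>a c. (if i = a then - b else 0) * (if a = j then b / s else 0)"])
    also have "\<dots> = (\<Sum>a<m. if a = j then (if i = j then - (b\<^sup>2 * of_nat n / s) else 0) else 0)"
      by (intro sum.cong) (auto simp: power2_eq_square)
    also have "\<dots> = - (if i = j then b\<^sup>2 * of_nat n / s else 0)"
      using ij by simp
    finally show ?thesis .
  qed
  then have "A + ?B * ?X =
      mat m m (\<lambda>(i, j). A $$ (i, j) - (if i = j then b\<^sup>2 * of_nat n / s else 0))"
    using A by (intro eq_matI) (auto simp del: index_mult_mat(1))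
  ultimately show ?thesis
    using det_block_diagonal[OF D, of m] by simp
qed

section \<open>Degrees, row sums and a vertex listing of the corona\<close>

lemma out_degree_with_proj: "out_degree (with_proj G) u = card {v. (u, v) \<in> parcs G}"
proof -
  have "out_arcs (with_proj G) u = Pair u ` {v. (u, v) \<in> parcs G}"
    by (auto simp: out_arcs_def)
  then show ?thesis
    by (simp add: out_degree_def card_image inj_on_def)
qed

lemma (in pair_fin_digraph) finite_out_neighbours: "finite {v. (u, v) \<in> parcs G}"
  using pair_finite_verts by (rule finite_subset[rotated]) (auto dest: in_arcsD2)

lemma out_degree_corona_Inl:
  assumes "pair_fin_digraph G" and "finite (pverts H)" and u: "u \<in> pverts G"
  shows "out_degree (with_proj (corona G H)) (Inl u) =
    out_degree (with_proj G) u + card (pverts H)"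
proof -
  have "{v. (Inl u, v) \<in> parcs (corona G H)} =
      Inl ` {v. (u, v) \<in> parcs G} \<union> Inr ` Pair u ` pverts H"
    using u by (auto simp: corona_def)
  then show ?thesis
    using assms pair_fin_digraph.finite_out_neighbours[OF assms(1), of u]
    by (auto simp: out_degree_with_proj card_image inj_on_def intro!: card_Un_disjoint[THEN trans])
qed

lemma out_degree_corona_Inr:
  fixes G :: "'a pair_pre_digraph" and H :: "'b pair_pre_digraph"
  assumes "pair_fin_digraph H" and "u \<in> pverts G" and "x \<in> pverts H"
  shows "out_degree (with_proj (corona G H)) (Inr (u, x)) = out_degree (with_proj H) x + 1"
proof -
  have "{v. (Inr (u, x), v) \<in> parcs (corona G H)} =
      insert (Inl u) (Inr ` Pair u ` {y. (x, y) \<in> parcs H})"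
    using assms by (auto simp: corona_def)
  moreover have "card (Inr ` Pair u ` {y. (x, y) \<in> parcs H} :: ('a + 'a \<times> 'b) set) =
      card {y. (x, y) \<in> parcs H}"
    by (simp add: card_image inj_on_def)
  ultimately show ?thesis
    using pair_fin_digraph.finite_out_neighbours[OF assms(1), of x]
    by (subst (1 2) out_degree_with_proj) (simp add: image_iff)
qed

text \<open>The degree matrix and the adjacency matrix have the same row sums, hence so does their
  combination with weights \<alpha> and 1 - \<alpha>. For a regular graph this makes the all-ones
  vector an eigenvector.\<close>

lemma A_alpha_row_sum:
  assumes "pair_fin_digraph G" and vs: "distinct vs" "set vs = pverts G" and i: "i < length vs"
  shows "(\<Sum>j<length vs. A_alpha \<alpha> vs G $$ (i, j)) = real (out_degree (with_proj G) (vs ! i))"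
proof -
  interpret pair_fin_digraph G by fact
  let ?d = "real (out_degree (with_proj G) (vs ! i))"
  have "bij_betw ((!) vs) {..<length vs} (pverts G)"
    using vs by (intro bij_betw_nth) auto
  then have "(\<Sum>j<length vs. if (vs ! i, vs ! j) \<in> parcs G then 1 else 0) =
      (\<Sum>v\<in>pverts G. if (vs ! i, v) \<in> parcs G then 1 else 0 :: real)"
    by (rule sum.reindex_bij_betw)
  also have "\<dots> = real (card {v \<in> pverts G. (vs ! i, v) \<in> parcs G})"
    using pair_finite_verts by (simp add: sum.If_cases Int_def)
  also have "{v \<in> pverts G. (vs ! i, v) \<in> parcs G} = {v. (vs ! i, v) \<in> parcs G}"
    by (auto dest: in_arcsD2)
  finally have adj: "(\<Sum>j<length vs. if (vs ! i, vs ! j) \<in> parcs G then 1 else 0) = ?d"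
    by (simp add: out_degree_with_proj)
  have "(\<Sum>j<length vs. A_alpha \<alpha> vs G $$ (i, j)) =
      \<alpha> * (\<Sum>j<length vs. if j = i then ?d else 0) +
      (1 - \<alpha>) * (\<Sum>j<length vs. if (vs ! i, vs ! j) \<in> parcs G then 1 else 0)"
    using i vs
    by (simp add: A_alpha_index nth_eq_iff_index_eq sum.distrib sum_distrib_left[symmetric])
  also have "\<dots> = ?d"
    using i adj by (simp add: algebra_simps)
  finally show ?thesis .
qed

text \<open>The quotient selects the copy and the remainder the vertex in it, which is the indexing
  of the blocks in \<open>det_corona_block\<close>.\<close>

definition corona_listing :: "'a list \<Rightarrow> 'b list \<Rightarrow> ('a + 'a \<times> 'b) list" where
  "corona_listing vs ws = map Inl vs @
     map (\<lambda>i. Inr (vs ! (i div length ws), ws ! (i mod length ws))) [0..<length vs * length ws]"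

lemma length_corona_listing [simp]:
  "length (corona_listing vs ws) = length vs + length vs * length ws"
  by (simp add: corona_listing_def)

lemma distinct_corona_listing:
  assumes "distinct vs" "distinct ws"
  shows "distinct (corona_listing vs ws)"
proof -
  have "i = j" if "i < length vs * length ws" "j < length vs * length ws"
    "vs ! (i div length ws) = vs ! (j div length ws)"
    "ws ! (i mod length ws) = ws ! (j mod length ws)" for i j
  proof -
    have "length ws > 0"
      using that by (cases ws) auto
    then have "i div length ws = j div length ws" "i mod length ws = j mod length ws"
      using that assms by (simp_all add: nth_eq_iff_index_eq less_mult_imp_div_less)
    then show ?thesis
      by (metis div_mult_mod_eq)
  qed
  then show ?thesis
    using assms by (auto simp: corona_listing_def distinct_map inj_on_def)
qed

lemma set_corona_listing:
  fixes G :: "'a pair_pre_digraph" and H :: "'b pair_pre_digraph"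
  assumes "set vs = pverts G" "set ws = pverts H"
  shows "set (corona_listing vs ws) = pverts (corona G H)"
proof -
  have "(vs ! a, ws ! b) \<in> (\<lambda>i. (vs ! (i div length ws), ws ! (i mod length ws))) `
      {0..<length vs * length ws}" if "a < length vs" "b < length ws" for a b
  \<comment> \<open>The witness is the number with quotient a and remainder b.\<close>
  proof (rule image_eqI[of _ _ "b + a * length ws"])
    have "b + a * length ws < Suc a * length ws"
      using that by simp
    also have "\<dots> \<le> length vs * length ws"
      using that by (intro mult_right_mono) auto
    finally show "b + a * length ws \<in> {0..<length vs * length ws}"
      by simp
    have "ws \<noteq> []"
      using that by auto
    then show "(vs ! a, ws ! b) = (vs ! ((b + a * length ws) div length ws),
        ws ! ((b + a * length ws) mod length ws))"
      using that by simp
  qed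
  then have "set vs \<times> set ws \<subseteq> (\<lambda>i. (vs ! (i div length ws), ws ! (i mod length ws))) `
      {0..<length vs * length ws}"
    by (auto simp: in_set_conv_nth)
  moreover have "(vs ! (i div length ws), ws ! (i mod length ws)) \<in> set vs \<times> set ws"
    if "i < length vs * length ws" for i
    using that by (cases "ws = []") (simp_all add: less_mult_imp_div_less)
  ultimately have "(\<lambda>i. (vs ! (i div length ws), ws ! (i mod length ws))) `
      {0..<length vs * length ws} = set vs \<times> set ws"
    by fastforce
  then have "(\<lambda>i. Inr (vs ! (i div length ws), ws ! (i mod length ws))) `
      {0..<length vs * length ws} = (Inr ` (set vs \<times> set ws) :: ('a + 'a \<times> 'b) set)"
    by (metis image_image)
  then show ?thesis
    using assms by (simp add: corona_listing_def corona_def)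
qed

section \<open>The characteristic polynomial of the corona\<close>

lemma poly_char_poly_corona:
  assumes G: "pair_graph G" and H: "pair_graph H" and reg: "regular_graph k H"
    and vs: "distinct vs" "set vs = pverts G" and ws: "distinct ws" "set ws = pverts H"
    and x: "x \<noteq> \<alpha> + real k"
  defines "m \<equiv> length vs" and "n \<equiv> length ws"
  shows "poly (char_poly (A_alpha \<alpha> (corona_listing vs ws) (corona G H))) x =
    poly (char_poly (A_alpha \<alpha> vs G))
      (x - \<alpha> * real n - (1 - \<alpha>)\<^sup>2 * real n / (x - \<alpha> - real k)) *
    poly (char_poly (A_alpha \<alpha> ws H)) (x - \<alpha>) ^ m"
proof -
  interpret G: pair_graph G by fact
  interpret H: pair_graph H by fact
  let ?us = "corona_listing vs ws" and ?b = "1 - \<alpha>"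
  let ?M = "A_alpha \<alpha> ?us (corona G H)"
  \<comment> \<open>In the corona a vertex of \<open>G\<close> gains n neighbours and a vertex in a
    copy of \<open>H\<close> gains one. The diagonal of \<open>?M\<close> thus grows by \<alpha> n
    and \<alpha> respectively, which gives the shifts of x in \<open>A\<close> and
    \<open>D\<close>.\<close>
  define A where
    "A = mat m m (\<lambda>(i, j). (if i = j then x - \<alpha> * real n else 0) - A_alpha \<alpha> vs G $$ (i, j))"
  define D where
    "D = mat n n (\<lambda>(i, j). (if i = j then x - \<alpha> else 0) - A_alpha \<alpha> ws H $$ (i, j))"
  have A: "A \<in> carrier_mat m m" and D: "D \<in> carrier_mat n n"
    by (simp_all add: A_def D_def)
  have cardH: "card (pverts H) = n"
    using ws by (metis distinct_card n_def)
  have us_left: "?us ! i = Inl (vs ! i)" if "i < m" for i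
    using that by (simp add: corona_listing_def nth_append m_def)
  have us_right: "?us ! i = Inr (vs ! ((i - m) div n), ws ! ((i - m) mod n))"
    if "m \<le> i" "i < m + m * n" for i
  proof -
    have "i - m < m * n"
      using that by simp
    then show ?thesis
      using that by (simp add: corona_listing_def nth_append m_def n_def)
  qed
  have div: "i div n < m" and mod: "i mod n < n" if "i < m * n" for i
    using that by (cases "n = 0"; simp add: less_mult_imp_div_less)+
  have vs_in: "vs ! i \<in> pverts G" if "i < m" for i
    using that vs(2) by (metis m_def nth_mem)
  have ws_in: "ws ! i \<in> pverts H" if "i < n" for i
    using that ws(2) by (metis n_def nth_mem)
  have vs_eq: "vs ! i = vs ! j \<longleftrightarrow> i = j" if "i < m" "j < m" for i j
    using that vs by (simp add: m_def nth_eq_iff_index_eq)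
  have ws_eq: "ws ! i = ws ! j \<longleftrightarrow> i = j" if "i < n" "j < n" for i j
    using that ws by (simp add: n_def nth_eq_iff_index_eq)
  have block_eq: "i = j \<longleftrightarrow> i div n = j div n \<and> i mod n = j mod n" for i j
    by (metis div_mult_mod_eq)
  have M: "?M $$ (i, j) =
      \<alpha> * (if i = j then real (out_degree (with_proj (corona G H)) (?us ! i)) else 0)
      + ?b * (if (?us ! i, ?us ! j) \<in> parcs (corona G H) then 1 else 0)"
    if "i < m + m * n" "j < m + m * n" for i j
    using that vs ws distinct_corona_listing[of vs ws]
    by (subst A_alpha_index) (auto simp: m_def n_def nth_eq_iff_index_eq)
  have arcs [simp]:
    "(Inl u, Inl v) \<in> parcs (corona G H) \<longleftrightarrow> (u, v) \<in> parcs G"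
    "(Inr (u, y), Inr (v, z)) \<in> parcs (corona G H) \<longleftrightarrow> u = v \<and> u \<in> pverts G \<and> (y, z) \<in> parcs H"
    "(Inl u, Inr (v, z)) \<in> parcs (corona G H) \<longleftrightarrow> u = v \<and> u \<in> pverts G \<and> z \<in> pverts H"
    "(Inr (v, z), Inl u) \<in> parcs (corona G H) \<longleftrightarrow> u = v \<and> u \<in> pverts G \<and> z \<in> pverts H"
    for u v y z
    by (auto simp: corona_def)
  have deg_left: "out_degree (with_proj (corona G H)) (Inl (vs ! i)) =
      out_degree (with_proj G) (vs ! i) + n" if "i < m" for i
    using out_degree_corona_Inl[of G H "vs ! i"] vs_in[OF that] cardH
      H.pair_finite_verts G.pair_fin_digraph_axioms by simp
  have deg_right: "out_degree (with_proj (corona G H)) (Inr (vs ! i, ws ! j)) =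
      out_degree (with_proj H) (ws ! j) + 1" if "i < m" "j < n" for i j
    using out_degree_corona_Inr[of H "vs ! i" G "ws ! j"] vs_in ws_in that
      H.pair_fin_digraph_axioms by simp
  have "mat (m + m * n) (m + m * n) (\<lambda>(i, j). (if i = j then x else 0) - ?M $$ (i, j)) =
      four_block_mat A
      (mat m (m * n) (\<lambda>(i, j). if i = j div n then - ?b else 0))
      (mat (m * n) m (\<lambda>(i, j). if i div n = j then - ?b else 0))
      (mat (m * n) (m * n) (\<lambda>(i, j). if i div n = j div n then D $$ (i mod n, j mod n) else 0))"
    (is "?L = ?R")
  proof (rule eq_matI)
    fix i j
    assume "i < dim_row ?R" "j < dim_col ?R"
    then have ij: "i < m + m * n" "j < m + m * n"
      using A by auto
    have L: "?L $$ (i, j) = (if i = j then x else 0) - ?M $$ (i, j)"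
      using ij by simp
    \<comment> \<open>One case per block, with m as the border between vertices of \<open>G\<close>
      and vertices in copies.\<close>
    consider "i < m" "j < m" | "i < m" "m \<le> j" | "m \<le> i" "j < m" | "m \<le> i" "m \<le> j"
      by linarith
    then show "?L $$ (i, j) = ?R $$ (i, j)"
    proof cases
      case 1
      then show ?thesis
        using ij A vs unfolding L M[OF ij]
        by (simp add: us_left deg_left A_def A_alpha_index vs_eq m_def[symmetric] algebra_simps)
    next
      case 2
      then have "j - m < m * n"
        using ij by simp
      with 2 show ?thesis
        using ij A unfolding L M[OF ij]
        by (simp add: us_left us_right vs_eq vs_in ws_in div mod)
    next
      case 3
      then have "i - m < m * n"
        using ij by simp
      with 3 show ?thesis
        using ij A unfolding L M[OF ij]
        by (auto simp: us_left us_right vs_eq vs_in ws_in div mod)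
    next
      case 4
      then have i: "i - m < m * n" and j: "j - m < m * n" and "i = j \<longleftrightarrow> i - m = j - m"
        using ij by auto
      \<comment> \<open>The diagonal test becomes a test on copy and vertex. Fixing the left index
        keeps the rule from rewriting the equations it produces.\<close>
      note this(3)[unfolded block_eq[of "i - m"]]
      with 4 show ?thesis
        using ij A ws i j mod[OF i] mod[OF j] div[OF i] div[OF j] unfolding L M[OF ij]
        by (auto simp: us_right deg_right D_def A_alpha_index ws_eq vs_eq vs_in n_def[symmetric]
            algebra_simps)
    qed
  qed (use A in auto)
  moreover have "?M \<in> carrier_mat (m + m * n) (m + m * n)"
    using A_alpha_carrier[of \<alpha> ?us "corona G H"] by (simp add: m_def n_def)
  \<comment> \<open>Regularity enters here: it supplies the constant row sum s of
    \<open>det_corona_block\<close>, nonzero by the choice of x.\<close>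
  moreover have "(\<Sum>j<n. D $$ (i, j)) = x - \<alpha> - real k" if "i < n" for i
  proof -
    have "(\<Sum>j<n. D $$ (i, j)) =
        (\<Sum>j<n. if i = j then x - \<alpha> else 0) - (\<Sum>j<n. A_alpha \<alpha> ws H $$ (i, j))"
      using that by (simp add: D_def sum_subtractf)
    also have "(\<Sum>j<n. A_alpha \<alpha> ws H $$ (i, j)) = real k"
      using A_alpha_row_sum[OF H.pair_fin_digraph_axioms ws] that ws_in[OF that] reg
      by (simp add: n_def regular_graph_def)
    finally show ?thesis
      using that by simp
  qed
  ultimately have "poly (char_poly ?M) x =
      det (mat m m (\<lambda>(i, j). A $$ (i, j) -
        (if i = j then ?b\<^sup>2 * of_nat n / (x - \<alpha> - real k) else 0))) * det D ^ m"
    using x by (simp add: poly_char_poly_eq_det[of _ "m + m * n"] det_corona_block[OF A D])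
  \<comment> \<open>The correction is a scalar matrix, so it is absorbed into the argument of the
    characteristic polynomial of \<open>G\<close>.\<close>
  also have "mat m m (\<lambda>(i, j). A $$ (i, j) -
        (if i = j then ?b\<^sup>2 * of_nat n / (x - \<alpha> - real k) else 0)) =
      mat m m (\<lambda>(i, j). (if i = j then x - \<alpha> * real n - ?b\<^sup>2 * real n / (x - \<alpha> - real k) else 0)
        - A_alpha \<alpha> vs G $$ (i, j))"
    by (rule eq_matI) (auto simp: A_def)
  finally show ?thesis
    using poly_char_poly_eq_det[OF A_alpha_carrier[of \<alpha> vs G]]
      poly_char_poly_eq_det[OF A_alpha_carrier[of \<alpha> ws H]]
    unfolding m_def[symmetric] n_def[symmetric] D_def by simp
qed

section \<open>Comparison of polynomials, and the spectrum of the corona\<close>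

lemma poly_eqI_cofinite:
  fixes p q :: "'a :: {idom, ring_char_0} poly"
  assumes "finite S" and "\<And>x. x \<notin> S \<Longrightarrow> poly p x = poly q x"
  shows "p = q"
proof (rule ccontr)
  assume "p \<noteq> q"
  then have "finite {x. poly (p - q) x = 0}"
    by (intro poly_roots_finite) simp
  moreover have "- S \<subseteq> {x. poly (p - q) x = 0}"
    using assms(2) by auto
  ultimately have "finite (- S)"
    using finite_subset by blast
  with \<open>finite S\<close> show False
    using infinite_UNIV_char_0 by auto
qed

theorem theorem3p2:
  fixes G1 :: "'a pair_pre_digraph" and G2 :: "'b pair_pre_digraph"
    and \<alpha> :: real and n1 n2 k :: nat and \<nu> \<eta> :: "nat \<Rightarrow> real"
  assumes "0 \<le> \<alpha>" and "\<alpha> \<le> 1"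
    and "pair_graph G1" and "Digraph_Component.connected (with_proj G1)" and "card (pverts G1) = n1"
    and "alpha_eigenvalues \<alpha> G1 = image_mset \<nu> (mset_set {1..n1})"
    and "pair_graph G2" and "Digraph_Component.connected (with_proj G2)" and "card (pverts G2) = n2"
    and "regular_graph k G2"
    and "alpha_eigenvalues \<alpha> G2 = image_mset \<eta> (mset_set {1..n2})"
    and "\<eta> 1 = real k"
    and "\<And>i j. 1 \<le> i \<Longrightarrow> i \<le> j \<Longrightarrow> j \<le> n2 \<Longrightarrow> \<eta> j \<le> \<eta> i"
  shows "alpha_eigenvalues \<alpha> (corona G1 G2) =
    (\<Sum>i = 1..n1.
      {# (\<nu> i + real k + \<alpha> * (real n2 + 1)
           + sqrt (\<alpha>\<^sup>2 * (real n2)\<^sup>2 + (real k + \<alpha> - \<nu> i)\<^sup>2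
                   + 2 * real n2 * (2 + \<alpha> * (\<nu> i + \<alpha> - real k - 4)))) / 2,
         (\<nu> i + real k + \<alpha> * (real n2 + 1)
           - sqrt (\<alpha>\<^sup>2 * (real n2)\<^sup>2 + (real k + \<alpha> - \<nu> i)\<^sup>2
                   + 2 * real n2 * (2 + \<alpha> * (\<nu> i + \<alpha> - real k - 4)))) / 2 #})
    + (\<Sum>j = 2..n2. replicate_mset n1 (\<eta> j + \<alpha>))"
proof -
  interpret G1: pair_graph G1 by fact
  interpret G2: pair_graph G2 by fact
  \<comment> \<open>For the quadratic (x - \<alpha> n2 - \<nu> i) (x - \<alpha> - k) - (1 -
    \<alpha>)^2 n2, \<open>c i\<close> is the sum of the roots and \<open>d i\<close> the square
    root of the discriminant. \<open>Q\<close> is the monic polynomial with the claimed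
    spectrum.\<close>
  define d where "d = (\<lambda>i. sqrt (\<alpha>\<^sup>2 * (real n2)\<^sup>2 + (real k + \<alpha> - \<nu> i)\<^sup>2
    + 2 * real n2 * (2 + \<alpha> * (\<nu> i + \<alpha> - real k - 4))))"
  define c where "c = (\<lambda>i. \<nu> i + real k + \<alpha> * (real n2 + 1))"
  define Q where "Q = (\<Prod>i = 1..n1. [:- ((c i + d i) / 2), 1:] * [:- ((c i - d i) / 2), 1:])
    * (\<Prod>j = 2..n2. [:- (\<eta> j + \<alpha>), 1:] ^ n1)"
  obtain vs where vs: "distinct vs" "set vs = pverts G1"
    using finite_distinct_list[OF G1.pair_finite_verts] by blast
  obtain ws where ws: "distinct ws" "set ws = pverts G2"
    using finite_distinct_list[OF G2.pair_finite_verts] by blast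
  have len: "length vs = n1" "length ws = n2"
    using vs ws assms(5,9) by (metis distinct_card)+
  let ?P = "char_poly (A_alpha \<alpha> (corona_listing vs ws) (corona G1 G2))"
  \<comment> \<open>Connectedness includes being nonempty, so the index 1 with
    \<open>\<eta> 1 = real k\<close> is in range and its factor can be split off.\<close>
  have "pverts G2 \<noteq> {}"
    using assms(8) by (auto simp: Digraph_Component.connected_def strongly_connected_def)
  then have "n2 > 0"
    using assms(9) G2.pair_finite_verts by (metis card_gt_0_iff)
  then have split: "(\<Prod>j = 1..n2. x - \<alpha> - \<eta> j) = (x - \<alpha> - real k) * (\<Prod>j = 2..n2. x - \<alpha> - \<eta> j)"
    for x
    using assms(12) by (simp add: prod.atLeast_Suc_atMost numeral_2_eq_2)
  have d_sq: "(d i)\<^sup>2 = (c i)\<^sup>2 - 4 * ((\<nu> i + \<alpha> * real n2) * (\<alpha> + real k) - (1 - \<alpha>)\<^sup>2 * real n2)"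
    for i
  proof -
    \<comment> \<open>As a square plus a nonnegative term the radicand is nonnegative, so squaring
      undoes \<open>sqrt\<close>.\<close>
    have disc: "\<alpha>\<^sup>2 * (real n2)\<^sup>2 + (real k + \<alpha> - \<nu> i)\<^sup>2
        + 2 * real n2 * (2 + \<alpha> * (\<nu> i + \<alpha> - real k - 4)) =
        (\<nu> i + \<alpha> * real n2 - \<alpha> - real k)\<^sup>2 + 4 * (1 - \<alpha>)\<^sup>2 * real n2"
      by (simp add: power2_eq_square algebra_simps)
    have "(d i)\<^sup>2 = (\<nu> i + \<alpha> * real n2 - \<alpha> - real k)\<^sup>2 + 4 * (1 - \<alpha>)\<^sup>2 * real n2"
      unfolding d_def disc by simp
    then show ?thesis
      by (simp add: c_def power2_eq_square algebra_simps)
  qed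
  have "?P = Q"
  proof (rule poly_eqI_cofinite[of "{\<alpha> + real k}"])
    fix x
    assume x: "x \<notin> {\<alpha> + real k}"
    let ?s = "x - \<alpha> - real k"
    let ?y = "x - \<alpha> * real n2 - (1 - \<alpha>)\<^sup>2 * real n2 / ?s"
    have factor: "(?y - \<nu> i) * ?s = (x - (c i + d i) / 2) * (x - (c i - d i) / 2)" for i
    proof -
      have "(?y - \<nu> i) * ?s = (x - \<alpha> * real n2 - \<nu> i) * ?s - (1 - \<alpha>)\<^sup>2 * real n2"
        using x by (simp add: left_diff_distrib)
      \<comment> \<open>By Vieta, the constant term is the product of the roots (c i + d i) / 2 and
        (c i - d i) / 2.\<close>
      also have "\<dots> = x\<^sup>2 - c i * x + ((c i)\<^sup>2 - (d i)\<^sup>2) / 4"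
        unfolding d_sq by (simp add: c_def power2_eq_square field_simps)
      also have "\<dots> = (x - (c i + d i) / 2) * (x - (c i - d i) / 2)"
        by (simp add: power2_eq_square field_simps)
      finally show ?thesis .
    qed
    have "poly ?P x = (\<Prod>i = 1..n1. ?y - \<nu> i) * (\<Prod>j = 1..n2. x - \<alpha> - \<eta> j) ^ n1"
      using poly_char_poly_corona[OF assms(3,7,10) vs ws, of x \<alpha>] x
        poly_char_poly_eq_prod[of "A_alpha \<alpha> vs G1" n1 \<nu> "{1..n1}" ?y]
        poly_char_poly_eq_prod[of "A_alpha \<alpha> ws G2" n2 \<eta> "{1..n2}" "x - \<alpha>"]
        alpha_eigenvalues_eq[OF vs, of \<alpha>] alpha_eigenvalues_eq[OF ws, of \<alpha>] assms(6,11)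
        A_alpha_carrier[of \<alpha> vs G1] A_alpha_carrier[of \<alpha> ws G2]
      by (simp add: len)
    \<comment> \<open>The n1 copies of \<open>?s\<close> coming from \<eta> 1 are handed out, one to
      each \<nu> i.\<close>
    also have "\<dots> = (\<Prod>i = 1..n1. (?y - \<nu> i) * ?s) * (\<Prod>j = 2..n2. x - \<alpha> - \<eta> j) ^ n1"
      unfolding split by (simp only: prod.distrib power_mult_distrib prod_constant) simp
    also have "\<dots> = poly Q x"
      unfolding factor Q_def by (simp add: poly_prod prod_power_distrib algebra_simps)
    finally show "poly ?P x = poly Q x" .
  qed simp
  moreover have "alpha_eigenvalues \<alpha> (corona G1 G2) = proots ?P"
    using vs ws by (intro alpha_eigenvalues_eq distinct_corona_listing set_corona_listing)
  moreover have "proots Q = (\<Sum>i = 1..n1. {#(c i + d i) / 2, (c i - d i) / 2#})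
      + (\<Sum>j = 2..n2. replicate_mset n1 (\<eta> j + \<alpha>))"
  proof -
    let ?q = "\<lambda>i. [:- ((c i + d i) / 2), 1:] * [:- ((c i - d i) / 2), 1:]"
    let ?l = "\<lambda>j. [:- (\<eta> j + \<alpha>), 1:] ^ n1"
    \<comment> \<open>\<open>proots\<close> turns products into sums only for nonzero
      factors.\<close>
    have nz: "?q i \<noteq> 0" "?l i \<noteq> 0" for i
      by (simp_all only: mult_eq_0_iff power_eq_0_iff pCons_eq_0_iff one_neq_zero simp_thms)
    have "proots (prod ?q {1..n1} * prod ?l {2..n2}) =
        proots (prod ?q {1..n1}) + proots (prod ?l {2..n2})"
      using nz by (intro proots_mult) (meson finite_atLeastAtMost prod_zero_iff)+
    then have "proots Q = (\<Sum>i = 1..n1. proots (?q i)) + (\<Sum>j = 2..n2. proots (?l j))"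
      unfolding Q_def proots_prod[of _ ?q, OF nz(1)] proots_prod[of _ ?l, OF nz(2)] .
    moreover have "proots (?q i) = {#(c i + d i) / 2, (c i - d i) / 2#}" for i
      by (subst proots_mult) auto
    moreover have "proots (?l j) = replicate_mset n1 (\<eta> j + \<alpha>)" for j
      by (simp add: proots_power add.commute)
    ultimately show ?thesis
      by (simp only:)
  qed
  ultimately show ?thesis
    by (simp add: c_def d_def)
qed

end
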